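(* Let $P$ be an $n\times n$ (entrywise) nonnegative matrix. Let $\mathcal{I}$ be the lattice (under inclusion) of all initial subsets for $P$, and let $\mathcal{F}_P$ be the lattice (under inclusion) of all $P$-invariant faces of $\mathbb{R}^n_+$. Then the association $I\mapsto F_I=\{x\in\mathbb{R}^n_+ : \operatorname{supp}(x)\subseteq I\}$ induces an isomorphism from the lattice $\mathcal{I}$ onto the lattice $\mathcal{F}_P$.
   Context: Write $\langle n\rangle=\{1,\dots,n\}$. For $x=(\xi_1,\dots,\xi_n)^T$, $\operatorname{supp}(x)=\{i:\xi_i\neq 0\}$. $\mathbb{R}^n_+$ is the nonnegative orthant. A subset $I\subseteq\langle n\rangle$ is an initial subset for $P$ if either $I=\emptyset$, or $I\ne\emptyset$ and $p_{ji}=0$ for all $j\in\langle n\rangle\setminus I$, $i\in I$. The initial subsets for $P$ form a sublattice of the lattice $2^{\langle n\rangle}$ of all subsets of $\langle n\rangle$ (meet is intersection, join is union). A face of a closed convex cone $K$ is a convex subcone $F\subseteq K$ (containing $0$) such that $x,y\in K$ and $x+y\in F$ imply $x,y\in F$; a face $F$ is $P$-invariant if $PF\subseteq F$. The faces of $\mathbb{R}^n_+$ form a lattice under inclusion with meet $F\cap G$ and join $F\vee G$ = the smallest face containing $F\cup G$; the $P$-invariant faces form a sublattice $\mathcal{F}_P$ of it. *)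

theory Defs
  imports "HOL-Analysis.Analysis" "HOL-Algebra.Lattice"
begin

definition supp :: "real ^ 'n \<Rightarrow> 'n set" where
  "supp x = {i. x $ i \<noteq> 0}"

definition nonneg_orthant :: "(real ^ 'n) set" where
  "nonneg_orthant = {x. \<forall>i. 0 \<le> x $ i}"

definition nonneg_matrix :: "real ^ 'n ^ 'm \<Rightarrow> bool" where
  "nonneg_matrix A \<longleftrightarrow> (\<forall>i j. 0 \<le> A $ i $ j)"

definition initial_subset :: "real ^ 'n ^ 'n \<Rightarrow> 'n set \<Rightarrow> bool" where
  "initial_subset P I \<longleftrightarrow> I = {} \<or> (I \<noteq> {} \<and> (\<forall>j \<in> UNIV - I. \<forall>i \<in> I. P $ j $ i = 0))"

text \<open>
  A face of a cone, as a convex subcone. The library's \<^const>\<open>face_of\<close> is a notion for convex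
  sets and also admits the empty set; \<^const>\<open>convex_cone\<close> forces \<open>0 \<in> F\<close>.
\<close>
definition cone_face :: "'a::real_vector set \<Rightarrow> 'a set \<Rightarrow> bool" where
  "cone_face K F \<longleftrightarrow>
     convex_cone F \<and> F \<subseteq> K \<and> (\<forall>x \<in> K. \<forall>y \<in> K. x + y \<in> F \<longrightarrow> x \<in> F \<and> y \<in> F)"

definition invariant_face :: "real ^ 'n ^ 'n \<Rightarrow> (real ^ 'n) set \<Rightarrow> bool" where
  "invariant_face P F \<longleftrightarrow> cone_face nonneg_orthant F \<and> (\<lambda>x. P *v x) ` F \<subseteq> F"

definition support_face :: "'n set \<Rightarrow> (real ^ 'n) set" where
  "support_face I = {x \<in> nonneg_orthant. supp x \<subseteq> I}"

definition inclusion_order :: "'a set set \<Rightarrow> 'a set gorder" where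
  "inclusion_order \<A> = \<lparr>carrier = \<A>, eq = (=), le = (\<subseteq>)\<rparr>"

abbreviation initial_lattice :: "real ^ 'n ^ 'n \<Rightarrow> 'n set gorder" where
  "initial_lattice P \<equiv> inclusion_order {I. initial_subset P I}"

abbreviation invariant_face_lattice :: "real ^ 'n ^ 'n \<Rightarrow> (real ^ 'n) set gorder" where
  "invariant_face_lattice P \<equiv> inclusion_order {F. invariant_face P F}"

text \<open>
  \<^const>\<open>join_pres\<close> and \<^const>\<open>meet_pres\<close> include the requirement that both orders are lattices.
\<close>
definition lattice_iso ::
  "('a, 'c) gorder_scheme \<Rightarrow> ('b, 'd) gorder_scheme \<Rightarrow> ('a \<Rightarrow> 'b) \<Rightarrow> bool" where
  "lattice_iso L M f \<longleftrightarrow>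
     bij_betw f (carrier L) (carrier M) \<and> join_pres L M f \<and> meet_pres L M f"


text \<open>
  Joins and meets of \<^const>\<open>inclusion_order\<close> are taken within the given family. The lemmas below
  show that they are the operations of the ambient lattices: union and intersection for initial
  subsets; intersection and the smallest face containing both for invariant faces.
\<close>

lemma inclusion_order_join:
  assumes "X \<in> \<A>" "Y \<in> \<A>" "S \<in> \<A>" "X \<subseteq> S" "Y \<subseteq> S"
    and "\<And>T. T \<in> \<A> \<Longrightarrow> X \<subseteq> T \<Longrightarrow> Y \<subseteq> T \<Longrightarrow> S \<subseteq> T"
  shows "X \<squnion>\<^bsub>inclusion_order \<A>\<^esub> Y = S"
proof -
  have bounds: "Upper (inclusion_order \<A>) {X, Y} = {T \<in> \<A>. X \<subseteq> T \<and> Y \<subseteq> T}"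
    using assms(1,2) by (auto simp: Upper_def inclusion_order_def)
  have "least (inclusion_order \<A>) T (Upper (inclusion_order \<A>) {X, Y}) \<longleftrightarrow> T = S" for T
  proof
    assume "least (inclusion_order \<A>) T (Upper (inclusion_order \<A>) {X, Y})"
    then have T: "T \<in> \<A>" "X \<subseteq> T" "Y \<subseteq> T" "T \<subseteq> S"
      using assms(3-5) unfolding least_def bounds by (simp_all add: inclusion_order_def)
    show "T = S"
      using assms(6)[OF T(1-3)] T(4) by (rule subset_antisym[rotated])
  next
    assume "T = S"
    then show "least (inclusion_order \<A>) T (Upper (inclusion_order \<A>) {X, Y})"
      unfolding least_def bounds
      using assms(3-6) by (simp add: inclusion_order_def Collect_restrict)
  qed
  then show ?thesis
    by (simp add: join_def Lattice.sup_def)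
qed

lemma inclusion_order_meet:
  assumes "X \<in> \<A>" "Y \<in> \<A>" "S \<in> \<A>" "S \<subseteq> X" "S \<subseteq> Y"
    and "\<And>T. T \<in> \<A> \<Longrightarrow> T \<subseteq> X \<Longrightarrow> T \<subseteq> Y \<Longrightarrow> T \<subseteq> S"
  shows "X \<sqinter>\<^bsub>inclusion_order \<A>\<^esub> Y = S"
proof -
  have bounds: "Lower (inclusion_order \<A>) {X, Y} = {T \<in> \<A>. T \<subseteq> X \<and> T \<subseteq> Y}"
    using assms(1,2) by (auto simp: Lower_def inclusion_order_def)
  have "greatest (inclusion_order \<A>) T (Lower (inclusion_order \<A>) {X, Y}) \<longleftrightarrow> T = S" for T
  proof
    assume "greatest (inclusion_order \<A>) T (Lower (inclusion_order \<A>) {X, Y})"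
    then have T: "T \<in> \<A>" "T \<subseteq> X" "T \<subseteq> Y" "S \<subseteq> T"
      using assms(3-5) unfolding greatest_def bounds by (simp_all add: inclusion_order_def)
    show "T = S"
      using assms(6)[OF T(1-3)] T(4) by (rule subset_antisym)
  next
    assume "T = S"
    then show "greatest (inclusion_order \<A>) T (Lower (inclusion_order \<A>) {X, Y})"
      unfolding greatest_def bounds
      using assms(3-6) by (simp add: inclusion_order_def Collect_restrict)
  qed
  then show ?thesis
    by (simp add: meet_def Lattice.inf_def)
qed

lemma initial_lattice_join:
  assumes "initial_subset P I" "initial_subset P J"
  shows "I \<squnion>\<^bsub>initial_lattice P\<^esub> J = I \<union> J"
proof -
  have "P $ j $ i = 0" if "j \<notin> I \<union> J" "i \<in> I \<union> J" for i j
    using that assms unfolding initial_subset_def by blast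
  then have "initial_subset P (I \<union> J)"
    unfolding initial_subset_def by blast
  with assms show ?thesis
    by (intro inclusion_order_join) simp_all
qed

lemma initial_lattice_meet:
  assumes "initial_subset P I" "initial_subset P J"
  shows "I \<sqinter>\<^bsub>initial_lattice P\<^esub> J = I \<inter> J"
proof -
  have "P $ j $ i = 0" if "j \<notin> I \<inter> J" "i \<in> I \<inter> J" for i j
    using that assms unfolding initial_subset_def by blast
  then have "initial_subset P (I \<inter> J)"
    unfolding initial_subset_def by blast
  with assms show ?thesis
    by (intro inclusion_order_meet) simp_all
qed

lemma cone_face_split:
  assumes "cone_face K F" "x \<in> K" "y \<in> K" "x + y \<in> F"
  shows "x \<in> F" "y \<in> F"
  using bspec[OF bspec[OF assms(1)[unfolded cone_face_def, THEN conjunct2, THEN conjunct2]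
    assms(2)] assms(3)] assms(4) by simp_all

lemma cone_faceI:
  assumes "convex_cone F" "F \<subseteq> K"
    and "\<And>x y. x \<in> K \<Longrightarrow> y \<in> K \<Longrightarrow> x + y \<in> F \<Longrightarrow> x \<in> F \<and> y \<in> F"
  shows "cone_face K F"
  unfolding cone_face_def using assms by simp

lemma cone_face_Int:
  assumes "cone_face K F" "cone_face K G"
  shows "cone_face K (F \<inter> G)"
proof (rule cone_faceI)
  have "convex_cone (\<Inter>{F, G})"
    using assms by (intro convex_cone_Inter) (auto simp only: cone_face_def)
  then show "convex_cone (F \<inter> G)" by simp
  show "F \<inter> G \<subseteq> K" using assms(1) by (simp add: cone_face_def le_infI1)
  fix x y assume "x \<in> K" "y \<in> K" "x + y \<in> F \<inter> G"
  then show "x \<in> F \<inter> G \<and> y \<in> F \<inter> G"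
    using cone_face_split[OF assms(1), of x y] cone_face_split[OF assms(2), of x y] by simp
qed

lemma invariant_face_lattice_meet:
  assumes "invariant_face P F" "invariant_face P G"
  shows "F \<sqinter>\<^bsub>invariant_face_lattice P\<^esub> G = F \<inter> G"
proof -
  have "invariant_face P (F \<inter> G)"
    using assms cone_face_Int[of nonneg_orthant F G]
    by (simp add: invariant_face_def image_subset_iff)
  with assms show ?thesis
    by (intro inclusion_order_meet) simp_all
qed

lemma invariant_face_lattice_join:
  assumes P: "nonneg_matrix P" and F: "invariant_face P F" and G: "invariant_face P G"
  shows "F \<squnion>\<^bsub>invariant_face_lattice P\<^esub> G = cone_face nonneg_orthant hull (F \<union> G)"
proof -
  let ?K = "nonneg_orthant :: (real ^ 'a) set"
  define H where "H = {x \<in> ?K. \<exists>f\<in>F. \<exists>g\<in>G. f + g - x \<in> ?K}"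
  have FG: "cone_face ?K F" "cone_face ?K G" "F \<subseteq> ?K" "G \<subseteq> ?K"
    "convex_cone F" "convex_cone G"
    using F G by (simp_all add: invariant_face_def cone_face_def)
  have add: "x + y \<in> ?K" if "x \<in> ?K" "y \<in> ?K" for x y
    using that by (auto simp: nonneg_orthant_def)
  have scale: "c *\<^sub>R x \<in> ?K" if "x \<in> ?K" "c \<ge> 0" for x c
    using that by (auto simp: nonneg_orthant_def)
  have zero: "0 \<in> ?K" "0 \<in> F" "0 \<in> G"
    using FG by (simp_all add: nonneg_orthant_def convex_cone_contains_0)
  have mult: "P *v x \<in> ?K" if "x \<in> ?K" for x
    using that P
    by (auto simp: nonneg_orthant_def nonneg_matrix_def matrix_vector_mult_def intro!: sum_nonneg)
  have HI: "x \<in> H" if "x \<in> ?K" "f \<in> F" "g \<in> G" "f + g - x \<in> ?K" for x f g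
    using that unfolding H_def by blast
  have HD: "\<exists>f\<in>F. \<exists>g\<in>G. f + g - x \<in> ?K" if "x \<in> H" for x
    using that by (simp add: H_def)
  have H_add: "x + y \<in> H" if xy: "x \<in> H" "y \<in> H" for x y
  proof -
    obtain f g f' g' where *: "f \<in> F" "g \<in> G" "f + g - x \<in> ?K"
      "f' \<in> F" "g' \<in> G" "f' + g' - y \<in> ?K" "x \<in> ?K" "y \<in> ?K"
      using xy unfolding H_def by blast
    have eq: "(f + f') + (g + g') - (x + y) = (f + g - x) + (f' + g' - y)" by simp
    have "(f + f') + (g + g') - (x + y) \<in> ?K"
      unfolding eq by (rule add) (fact *)+
    then show ?thesis
      by (rule HI[OF add[OF *(7,8)] convex_cone_add[OF FG(5) *(1,4)]
            convex_cone_add[OF FG(6) *(2,5)]])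
  qed
  have H_scale: "c *\<^sub>R x \<in> H" if xc: "x \<in> H" "c \<ge> 0" for x c
  proof -
    obtain f g where *: "f \<in> F" "g \<in> G" "f + g - x \<in> ?K" "x \<in> ?K"
      using xc unfolding H_def by blast
    have eq: "c *\<^sub>R f + c *\<^sub>R g - c *\<^sub>R x = c *\<^sub>R (f + g - x)"
      by (simp add: algebra_simps)
    have "c *\<^sub>R f + c *\<^sub>R g - c *\<^sub>R x \<in> ?K"
      unfolding eq by (rule scale) (fact *(3) xc(2))+
    then show ?thesis
      by (rule HI[OF scale[OF *(4) xc(2)] convex_cone_scaleR[OF FG(5) xc(2) *(1)]
            convex_cone_scaleR[OF FG(6) xc(2) *(2)]])
  qed
  have H_face: "x \<in> H" if xy: "x \<in> ?K" "y \<in> ?K" "x + y \<in> H" for x y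
  proof -
    obtain f g where *: "f \<in> F" "g \<in> G" "f + g - (x + y) \<in> ?K"
      using HD[OF xy(3)] by blast
    have "f + g - x \<in> ?K" using add[OF *(3) xy(2)] by (simp add: algebra_simps)
    then show ?thesis by (rule HI[OF xy(1) *(1,2)])
  qed
  have FH: "F \<subseteq> H" and GH: "G \<subseteq> H"
  proof -
    show "F \<subseteq> H"
      using HI[of _ _ 0] FG(3) zero by (simp add: subset_iff)
    show "G \<subseteq> H"
      using HI[of _ 0] FG(4) zero by (simp add: subset_iff)
  qed
  have "cone_face ?K H"
  proof (rule cone_faceI)
    show "convex_cone H"
      unfolding convex_cone_iff
    proof (intro conjI ballI allI impI)
      show "0 \<in> H" using FH zero by blast
    qed (fact H_add H_scale)+
    show "H \<subseteq> ?K" unfolding H_def by blast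
    show "x \<in> H \<and> y \<in> H" if "x \<in> ?K" "y \<in> ?K" "x + y \<in> H" for x y
      using H_face[of x y] H_face[of y x] that by (simp add: add.commute)
  qed
  moreover have "P *v x \<in> H" if x: "x \<in> H" for x
  proof -
    obtain f g where *: "f \<in> F" "g \<in> G" "f + g - x \<in> ?K" "x \<in> ?K"
      using x unfolding H_def by blast
    have eq: "P *v f + P *v g - P *v x = P *v (f + g - x)"
      by (simp add: matrix_vector_mult_diff_distrib matrix_vector_right_distrib)
    have "P *v f + P *v g - P *v x \<in> ?K"
      unfolding eq by (rule mult) (fact *)
    moreover have "P *v f \<in> F" "P *v g \<in> G"
      using F G * by (simp_all add: invariant_face_def image_subset_iff)
    ultimately show ?thesis
      using HI[OF mult[OF *(4)]] by simp
  qed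
  ultimately have H: "invariant_face P H" by (simp add: invariant_face_def image_subset_iff)
  have least: "H \<subseteq> T" if T: "cone_face ?K T" "F \<subseteq> T" "G \<subseteq> T" for T
  proof
    fix x assume "x \<in> H"
    then obtain f g where *: "f \<in> F" "g \<in> G" "f + g - x \<in> ?K" "x \<in> ?K"
      unfolding H_def by blast
    have "convex_cone T" using T(1) by (simp add: cone_face_def)
    then have "f + g \<in> T"
      using * T(2,3) by (simp add: convex_cone_add subset_iff)
    then show "x \<in> T" using cone_face_split(1)[OF T(1) *(4,3)] by simp
  qed
  have "cone_face ?K hull (F \<union> G) = H"
    by (rule hull_unique) (use FH GH H least in \<open>simp_all add: invariant_face_def\<close>)
  moreover have "F \<squnion>\<^bsub>invariant_face_lattice P\<^esub> G = H"
    by (rule inclusion_order_join) (use F G FH GH H least in \<open>simp_all add: invariant_face_def\<close>)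
  ultimately show ?thesis by simp
qed

end

(* A face F of the orthant is determined by the standard basis vectors it contains: a nonzero
   coordinate of x in F splits off a positive multiple of its basis vector, and conversely every
   nonnegative x is a conic combination of the basis vectors of its support. As P maps the i-th basis
   vector to the i-th column of P, invariance of F_I says that the columns indexed by I are supported
   in I, i.e. that I is initial. Thus F_I is an order isomorphism, hence a lattice isomorphism. *)

theory Submission
  imports Defs
begin

text \<open>\<open>join_pres\<close> and \<open>meet_pres\<close> demand that both orders be
  lattices. Inclusion is always a partial order, so only binary suprema and infima within the family
  remain to be supplied.\<close>

lemma lattice_inclusion_order:
  assumes "\<And>X Y. X \<in> \<A> \<Longrightarrow> Y \<in> \<A> \<Longrightarrow>
      \<exists>S\<in>\<A>. X \<subseteq> S \<and> Y \<subseteq> S \<and> (\<forall>T\<in>\<A>. X \<subseteq> T \<longrightarrow> Y \<subseteq> T \<longrightarrow> S \<subseteq> T)"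
    and "\<And>X Y. X \<in> \<A> \<Longrightarrow> Y \<in> \<A> \<Longrightarrow>
      \<exists>S\<in>\<A>. S \<subseteq> X \<and> S \<subseteq> Y \<and> (\<forall>T\<in>\<A>. T \<subseteq> X \<longrightarrow> T \<subseteq> Y \<longrightarrow> T \<subseteq> S)"
  shows "lattice (inclusion_order \<A>)"
proof
  fix X Y
  assume "X \<in> carrier (inclusion_order \<A>)" "Y \<in> carrier (inclusion_order \<A>)"
  then have XY: "X \<in> \<A>" "Y \<in> \<A>"
    by (simp_all add: inclusion_order_def)
  show "\<exists>S. least (inclusion_order \<A>) S (Upper (inclusion_order \<A>) {X, Y})"
  proof -
    have "Upper (inclusion_order \<A>) {X, Y} = {T \<in> \<A>. X \<subseteq> T \<and> Y \<subseteq> T}"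
      using XY by (auto simp: Upper_def inclusion_order_def)
    moreover obtain S where "S \<in> \<A>" "X \<subseteq> S" "Y \<subseteq> S" "\<forall>T\<in>\<A>. X \<subseteq> T \<longrightarrow> Y \<subseteq> T \<longrightarrow> S \<subseteq> T"
      using assms(1)[OF XY] by (elim bexE conjE)
    ultimately have "least (inclusion_order \<A>) S (Upper (inclusion_order \<A>) {X, Y})"
      by (simp add: least_def inclusion_order_def Collect_restrict)
    then show ?thesis ..
  qed
  show "\<exists>S. greatest (inclusion_order \<A>) S (Lower (inclusion_order \<A>) {X, Y})"
  proof -
    have "Lower (inclusion_order \<A>) {X, Y} = {T \<in> \<A>. T \<subseteq> X \<and> T \<subseteq> Y}"
      using XY by (auto simp: Lower_def inclusion_order_def)
    moreover obtain S where "S \<in> \<A>" "S \<subseteq> X" "S \<subseteq> Y" "\<forall>T\<in>\<A>. T \<subseteq> X \<longrightarrow> T \<subseteq> Y \<longrightarrow> T \<subseteq> S"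
      using assms(2)[OF XY] by (elim bexE conjE)
    ultimately have "greatest (inclusion_order \<A>) S (Lower (inclusion_order \<A>) {X, Y})"
      by (simp add: greatest_def inclusion_order_def Collect_restrict)
    then show ?thesis ..
  qed
qed (auto simp: inclusion_order_def)

text \<open>A bijection that preserves and reflects inclusion carries suprema to suprema and infima
  to infima. In \<open>\<A>\<close> these are unions and intersections, and the lattice structure of
  \<open>\<B>\<close> is transported along \<open>f\<close>. No closure of \<open>\<B>\<close> under
  union is assumed, since a join of faces is in general larger than their union.\<close>

lemma lattice_iso_inclusion_orderI:
  assumes bij: "bij_betw f \<A> \<B>"
    and mono: "\<And>X Y. X \<in> \<A> \<Longrightarrow> Y \<in> \<A> \<Longrightarrow> f X \<subseteq> f Y \<longleftrightarrow> X \<subseteq> Y"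
    and Un: "\<And>X Y. X \<in> \<A> \<Longrightarrow> Y \<in> \<A> \<Longrightarrow> X \<union> Y \<in> \<A>"
    and Int: "\<And>X Y. X \<in> \<A> \<Longrightarrow> Y \<in> \<A> \<Longrightarrow> X \<inter> Y \<in> \<A>"
  shows "lattice_iso (inclusion_order \<A>) (inclusion_order \<B>) f"
proof -
  have image: "\<B> = f ` \<A>"
    using bij by (simp add: bij_betw_def)
  then have mem: "f X \<in> \<B>" if "X \<in> \<A>" for X
    using that by simp
  have A: "lattice (inclusion_order \<A>)"
  proof (rule lattice_inclusion_order)
    fix X Y assume XY: "X \<in> \<A>" "Y \<in> \<A>"
    show "\<exists>S\<in>\<A>. X \<subseteq> S \<and> Y \<subseteq> S \<and> (\<forall>T\<in>\<A>. X \<subseteq> T \<longrightarrow> Y \<subseteq> T \<longrightarrow> S \<subseteq> T)"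
      using Un[OF XY] by (intro bexI[of _ "X \<union> Y"]) auto
    show "\<exists>S\<in>\<A>. S \<subseteq> X \<and> S \<subseteq> Y \<and> (\<forall>T\<in>\<A>. T \<subseteq> X \<longrightarrow> T \<subseteq> Y \<longrightarrow> T \<subseteq> S)"
      using Int[OF XY] by (intro bexI[of _ "X \<inter> Y"]) auto
  qed
  \<comment> \<open>Every competing upper bound in \<open>\<B>\<close> is \<open>f Z\<close> for
    some \<open>Z\<close> in \<open>\<A>\<close>, so \<open>mono\<close> reduces leastness of
    \<open>f (X \<union> Y)\<close> to leastness of the union.\<close>
  have sup: "f (X \<union> Y) \<in> \<B>" "f X \<subseteq> f (X \<union> Y)" "f Y \<subseteq> f (X \<union> Y)"
    "\<forall>T\<in>\<B>. f X \<subseteq> T \<longrightarrow> f Y \<subseteq> T \<longrightarrow> f (X \<union> Y) \<subseteq> T"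
    if "X \<in> \<A>" "Y \<in> \<A>" for X Y
    using that Un[OF that] by (simp_all add: image mono imageI)
  have inf: "f (X \<inter> Y) \<in> \<B>" "f (X \<inter> Y) \<subseteq> f X" "f (X \<inter> Y) \<subseteq> f Y"
    "\<forall>T\<in>\<B>. T \<subseteq> f X \<longrightarrow> T \<subseteq> f Y \<longrightarrow> T \<subseteq> f (X \<inter> Y)"
    if "X \<in> \<A>" "Y \<in> \<A>" for X Y
    using that Int[OF that] by (simp_all add: image mono imageI)
  have B: "lattice (inclusion_order \<B>)"
  proof (rule lattice_inclusion_order)
    fix X Y assume "X \<in> \<B>" "Y \<in> \<B>"
    then obtain X' Y' where XY: "X = f X'" "Y = f Y'" "X' \<in> \<A>" "Y' \<in> \<A>"
      unfolding image by blast
    show "\<exists>S\<in>\<B>. X \<subseteq> S \<and> Y \<subseteq> S \<and> (\<forall>T\<in>\<B>. X \<subseteq> T \<longrightarrow> Y \<subseteq> T \<longrightarrow> S \<subseteq> T)"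
      using sup[OF XY(3,4)] unfolding XY(1,2) by (intro bexI[of _ "f (X' \<union> Y')"]) simp_all
    show "\<exists>S\<in>\<B>. S \<subseteq> X \<and> S \<subseteq> Y \<and> (\<forall>T\<in>\<B>. T \<subseteq> X \<longrightarrow> T \<subseteq> Y \<longrightarrow> T \<subseteq> S)"
      using inf[OF XY(3,4)] unfolding XY(1,2) by (intro bexI[of _ "f (X' \<inter> Y')"]) simp_all
  qed
  have carrier: "carrier (inclusion_order \<C>) = \<C>" for \<C> :: "'c set set"
    by (simp add: inclusion_order_def)
  have "f (X \<squnion>\<^bsub>inclusion_order \<A>\<^esub> Y) = f X \<squnion>\<^bsub>inclusion_order \<B>\<^esub> f Y"
    if XY: "X \<in> \<A>" "Y \<in> \<A>" for X Y
  proof -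
    have "X \<squnion>\<^bsub>inclusion_order \<A>\<^esub> Y = X \<union> Y"
      using XY Un[OF XY] by (intro inclusion_order_join) simp_all
    moreover have "f X \<squnion>\<^bsub>inclusion_order \<B>\<^esub> f Y = f (X \<union> Y)"
      using XY sup[OF XY] by (intro inclusion_order_join) (simp_all add: mem)
    ultimately show ?thesis by simp
  qed
  moreover have "f (X \<sqinter>\<^bsub>inclusion_order \<A>\<^esub> Y) = f X \<sqinter>\<^bsub>inclusion_order \<B>\<^esub> f Y"
    if XY: "X \<in> \<A>" "Y \<in> \<A>" for X Y
  proof -
    have "X \<sqinter>\<^bsub>inclusion_order \<A>\<^esub> Y = X \<inter> Y"
      using XY Int[OF XY] by (intro inclusion_order_meet) simp_all
    moreover have "f X \<sqinter>\<^bsub>inclusion_order \<B>\<^esub> f Y = f (X \<inter> Y)"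
      using XY inf[OF XY] by (intro inclusion_order_meet) (simp_all add: mem)
    ultimately show ?thesis by simp
  qed
  ultimately show ?thesis
    using bij A B by (simp add: lattice_iso_def join_pres_def meet_pres_def carrier)
qed

lemma support_face_iff:
  "x \<in> support_face I \<longleftrightarrow> (\<forall>i. 0 \<le> x $ i) \<and> (\<forall>i. i \<notin> I \<longrightarrow> x $ i = 0)"
  by (auto simp: support_face_def nonneg_orthant_def supp_def)

text \<open>The standard basis vectors serve as test vectors that recover the index set from its
  face.\<close>

lemma axis_in_support_face: "axis i 1 \<in> support_face I \<longleftrightarrow> i \<in> I"
  by (auto simp: support_face_iff axis_def)

lemma support_face_subset_iff: "support_face I \<subseteq> support_face J \<longleftrightarrow> I \<subseteq> J"
proof
  assume "support_face I \<subseteq> support_face J"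
  then show "I \<subseteq> J"
    using axis_in_support_face by blast
qed (auto simp: support_face_def)

text \<open>Two nonnegative reals with sum 0 both vanish, so a coordinate that is zero in
  \<open>x + y\<close> is zero in each summand.\<close>

lemma cone_face_support_face: "cone_face nonneg_orthant (support_face I)"
  by (rule cone_faceI)
    (auto simp: convex_cone_iff support_face_iff nonneg_orthant_def add_nonneg_eq_0_iff)

lemma cone_face_orthant_eq_support_face:
  fixes F :: "(real ^ 'n) set"
  assumes F: "cone_face nonneg_orthant F"
  shows "F = support_face {i. axis i 1 \<in> F}"
proof
  have cone: "convex_cone F" and sub: "F \<subseteq> nonneg_orthant"
    using F by (simp_all add: cone_face_def)
  show "F \<subseteq> support_face {i. axis i 1 \<in> F}"
  proof
    fix x assume x: "x \<in> F"
    then have nonneg: "0 \<le> x $ i" for i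
      using sub by (auto simp: nonneg_orthant_def)
    have "axis i 1 \<in> F" if "x $ i \<noteq> 0" for i
    proof -
      \<comment> \<open>Split \<open>x\<close> into its i-th coordinate part and the rest. Both lie
        in the orthant, so the face property puts the first into \<open>F\<close>.\<close>
      have "axis i (x $ i) \<in> nonneg_orthant" "x - axis i (x $ i) \<in> nonneg_orthant"
        using nonneg by (auto simp: nonneg_orthant_def axis_def)
      then have "axis i (x $ i) \<in> F"
        using cone_face_split(1)[OF F, of "axis i (x $ i)" "x - axis i (x $ i)"] x by simp
      then have "inverse (x $ i) *\<^sub>R axis i (x $ i) \<in> F"
        using nonneg by (intro convex_cone_scaleR[OF cone]) simp_all
      also have "inverse (x $ i) *\<^sub>R axis i (x $ i) = axis i 1"
        using that by (simp add: vec_eq_iff axis_def)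
      finally show ?thesis .
    qed
    then show "x \<in> support_face {i. axis i 1 \<in> F}"
      using nonneg by (auto simp: support_face_iff)
  qed
  show "support_face {i. axis i 1 \<in> F} \<subseteq> F"
  proof
    fix x assume x: "x \<in> support_face {i. axis i 1 \<in> F}"
    have "x $ i *\<^sub>R axis i 1 \<in> F" for i
    proof (cases "axis i 1 \<in> F")
      case True
      with x show ?thesis
        by (intro convex_cone_scaleR[OF cone]) (simp_all add: support_face_iff)
    next
      case False
      with x show ?thesis
        by (simp add: support_face_iff convex_cone_contains_0[OF cone])
    qed
    \<comment> \<open>The index set is generalized from \<open>UNIV\<close> to make induction
      possible. In the infinite case the sum is 0 by convention, which lies in
      \<open>F\<close>.\<close>
    then have "(\<Sum>i\<in>A. x $ i *\<^sub>R axis i 1) \<in> F" for A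
      by (induction A rule: infinite_finite_induct)
        (simp_all add: convex_cone_contains_0[OF cone] convex_cone_add[OF cone])
    moreover have "(\<Sum>i\<in>UNIV. x $ i *\<^sub>R axis i 1) = x"
      using basis_expansion[of x] by (simp add: scalar_mult_eq_scaleR)
    ultimately show "x \<in> F"
      by metis
  qed
qed

lemma initial_subset_iff: "initial_subset P I \<longleftrightarrow> (\<forall>i\<in>I. \<forall>j. j \<notin> I \<longrightarrow> P $ j $ i = 0)"
  by (auto simp: initial_subset_def)

lemma invariant_support_face_iff:
  assumes "nonneg_matrix P"
  shows "invariant_face P (support_face I) \<longleftrightarrow> initial_subset P I"
proof
  assume "invariant_face P (support_face I)"
  \<comment> \<open>Testing invariance on basis vectors suffices, as their images are the columns of
    \<open>P\<close>.\<close>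
  then have "P *v axis i 1 \<in> support_face I" if "i \<in> I" for i
    using that by (auto simp: invariant_face_def axis_in_support_face)
  then have "column i P \<in> support_face I" if "i \<in> I" for i
    using that by (simp add: matrix_vector_mult_basis)
  then show "initial_subset P I"
    by (simp add: initial_subset_iff support_face_iff column_def)
next
  assume I: "initial_subset P I"
  have "P *v x \<in> support_face I" if x: "x \<in> support_face I" for x
  proof -
    \<comment> \<open>For \<open>j\<close> outside \<open>I\<close>, the matrix entry vanishes if
      \<open>i\<close> is in \<open>I\<close> because \<open>I\<close> is initial; otherwise the
      coordinate of \<open>x\<close> vanishes. Hence every term of the j-th coordinate of
      \<open>P *v x\<close> is zero.\<close>
    have zero: "P $ j $ i * x $ i = 0" if "j \<notin> I" for i j
      using that I x by (cases "i \<in> I") (auto simp: initial_subset_iff support_face_iff)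
    have "0 \<le> P $ j $ i * x $ i" for i j
      using assms x by (simp add: nonneg_matrix_def support_face_iff)
    then show ?thesis
      by (simp add: support_face_iff matrix_vector_mult_def sum_nonneg zero del: mult_eq_0_iff)
  qed
  then show "invariant_face P (support_face I)"
    by (auto simp: invariant_face_def cone_face_support_face)
qed

theorem theorem3p1:
  fixes P :: "real ^ 'n ^ 'n"
  assumes "nonneg_matrix P"
  shows "lattice_iso (initial_lattice P) (invariant_face_lattice P) support_face"
proof (rule lattice_iso_inclusion_orderI)
  show "bij_betw support_face {I. initial_subset P I} {F. invariant_face P F}"
    unfolding bij_betw_def
  proof
    show "inj_on support_face {I. initial_subset P I}"
      \<comment> \<open>Equal faces contain each other, and each inclusion of faces reflects to one
        of index sets.\<close>
      by (intro inj_onI subset_antisym) (simp_all flip: support_face_subset_iff)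
    have "F \<in> support_face ` {I. initial_subset P I}" if F: "invariant_face P F" for F
    proof -
      \<comment> \<open>The index set is the set of basis vectors in \<open>F\<close>; the
        invariance of \<open>F\<close> then makes it initial.\<close>
      obtain I where "F = support_face I"
        using F cone_face_orthant_eq_support_face unfolding invariant_face_def by blast
      with F show ?thesis
        by (simp add: invariant_support_face_iff[OF assms])
    qed
    then show "support_face ` {I. initial_subset P I} = {F. invariant_face P F}"
      by (auto simp: invariant_support_face_iff[OF assms])
  qed
\<comment> \<open>What is left is the order embedding and the closure of initial subsets under union
  and intersection.\<close>
qed (auto simp: support_face_subset_iff initial_subset_iff)

end
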